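(* For $n\ge1$ and $0\le r\le 2n$, the average height of the $r$th vertex over all paths in $\mathcal D_n$ equals $$\frac{\delta_r+r(2n-r)}{n}\cdot\frac{\binom{r}{\lfloor r/2 \rfloor}\binom{2n-r}{n-\lfloor r/2\rfloor}}{\binom{2n}{n}}-1,$$ where $\delta_r=n$ if $r$ is even and $\delta_r=2n+1$ if $r$ is odd. As $n\to\infty$, this average is asymptotically equal to $$\begin{cases} \displaystyle\frac{2r+1}{2^r}\binom{r}{r/2}-1 & \text{if $r$ is fixed and even},\\[2mm] \displaystyle\frac{2r+2}{2^r}\binom{r}{(r-1)/2}-1 & \text{if $r$ is fixed and odd},\\[2mm] \displaystyle\frac{2}{\sqrt{\pi}}\sqrt{r\left(2-\frac{r}{n}\right)} & \text{if $r=r(n)$ is such that $r\to\infty$ and $2n-r\to\infty$}. \end{cases}$$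
   Context: A Dyck path of semilength $n$ is a lattice path in $\mathbb Z^2$ with steps $(1,1)$ and $(1,-1)$ that starts at $(0,0)$, ends at $(2n,0)$, and never goes below the $x$-axis; $\mathcal D_n$ is the set of these. The vertices of a path in $\mathcal D_n$ are indexed $0,1,\dots,2n$ from left to right, so the $r$th vertex is the one with $x$-coordinate $r$; its height is its $y$-coordinate. The average is over the uniform distribution on $\mathcal D_n$. For fixed $r$, "asymptotically equal" means that the average converges to the displayed constant; when $r=r(n)$ varies, it means that the ratio of the two quantities tends to $1$. *)

theory Defs
  imports Complex_Main "HOL-Library.Product_Plus"
begin

text \<open>A lattice path is given by the list of its vertices, so \<open>p ! r\<close> is the \<open>r\<close>th vertex.
  The step and endpoint conditions force \<open>length p = 2 * n + 1\<close> and \<open>fst (p ! r) = r\<close>.\<close>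

definition dyck_paths :: "nat \<Rightarrow> (int \<times> int) list set" where
  "dyck_paths n = {p. p \<noteq> [] \<and> hd p = (0, 0) \<and> last p = (2 * int n, 0) \<and>
     (\<forall>i. Suc i < length p \<longrightarrow> p ! Suc i - p ! i \<in> {(1, 1), (1, -1)}) \<and>
     (\<forall>v\<in>set p. snd v \<ge> 0)}"

definition vertex_height :: "(int \<times> int) list \<Rightarrow> nat \<Rightarrow> int" where
  "vertex_height p r = snd (p ! r)"

text \<open>Only meaningful for \<open>r \<le> 2 * n\<close>.\<close>

definition average_height :: "nat \<Rightarrow> nat \<Rightarrow> real" where
  "average_height n r =
     (\<Sum>p\<in>dyck_paths n. real_of_int (vertex_height p r)) / real (card (dyck_paths n))"

definition dyck_delta :: "nat \<Rightarrow> nat \<Rightarrow> nat" where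
  "dyck_delta n r = (if even r then n else 2 * n + 1)"

end

theory Submission
  imports Defs "HOL-Analysis.Gamma_Function" "HOL-Real_Asymp.Real_Asymp"
begin

text \<open>Write \<open>B r h\<close> for the number of nonnegative \<open>\<plusminus>1\<close> paths with \<open>r\<close> steps between heights
  \<open>0\<close> and \<open>h\<close> (the ballot number, \<open>ballot r h\<close> below).  Cutting a Dyck path at its \<open>r\<close>th vertex
  and putting \<open>s = 2 * n - r\<close>, the sum of the heights of the \<open>r\<close>th vertices is
  \<open>\<Sum>h. h * B r h * B s h\<close>, and the number of paths is \<open>\<Sum>h. B r h * B s h = B (2 * n) 0\<close>.  Hence
  the average height plus one is \<open>\<Sum>h. (h + 1) * B r h * B s h\<close> divided by the Catalan number; the
  closed form has the term \<open>- 1\<close> because it is the weight \<open>h + 1\<close>, not \<open>h\<close>, for which the sum is a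
  single product (lemma \<open>average_height_plus_1\<close>).

  The cutting is done algebraically.  Splitting off the first step of a path turns sums over paths
  into iterates of the operator \<open>neighbour_sum\<close>, the adjacency operator of the half-line
  \<open>0 - 1 - 2 - \<dots>\<close>.  That operator is symmetric, so its iterates can be moved from one factor of
  a sum over heights to the other (lemma \<open>neighbour_sum_funpow_0\<close>), and no concatenation of paths
  is needed.

  The ballot numbers are \<open>B r h = (h + 1) / (r + 1) * W r h\<close> with a binomial coefficient \<open>W r h\<close>, so the
  sum to be evaluated is that of \<open>(h + 1)^3 * W r h * W s h\<close>.  This summand is Gosper summable in
  steps of two: it is a multiple of \<open>T h - T (h + 2)\<close> for an explicit hypergeometric term \<open>T\<close>
  (lemma \<open>sum_ballot_ballot\<close>).  Only \<open>T 0\<close> and \<open>T 1\<close> survive, of which one vanishes by parity.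

  For the limits, put \<open>c m = (m choose (m div 2)) / 2 ^ m\<close>.  The quotient of the binomial coefficients
  in the closed form is \<open>c r * c s / c (2 * n)\<close>, the powers of two cancelling, and
  \<open>c m * sqrt m\<close> tends to \<open>sqrt (2 / pi)\<close> (lemma \<open>tendsto_central_ratio\<close>).  All three limits follow
  from these facts.\<close>

section \<open>Decomposing paths by their first step\<close>

definition dyck_step :: "int \<times> int \<Rightarrow> int \<times> int \<Rightarrow> bool" where
  "dyck_step u v \<longleftrightarrow> v - u \<in> {(1, 1), (1, -1)}"

lemma dyck_step_iff: "dyck_step (x, h) v \<longleftrightarrow> v = (x + 1, h + 1) \<or> v = (x + 1, h - 1)"
  by (cases v) (auto simp: dyck_step_def)

text \<open>The starting point is arbitrary so that removing the first vertex stays inside the family.\<close>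

definition paths_to_axis :: "nat \<Rightarrow> int \<Rightarrow> int \<Rightarrow> (int \<times> int) list set" where
  "paths_to_axis N x h = {p. p \<noteq> [] \<and> hd p = (x, h) \<and> last p = (x + int N, 0) \<and>
     successively dyck_step p \<and> (\<forall>v\<in>set p. snd v \<ge> 0)}"

lemma dyck_paths_eq_paths_to_axis: "dyck_paths n = paths_to_axis (2 * n) 0 0"
  by (simp only: dyck_paths_def paths_to_axis_def successively_conv_nth dyck_step_def
      of_nat_mult of_nat_numeral add_0)

lemma fst_last_path:
  assumes "successively dyck_step p" "p \<noteq> []"
  shows "fst (last p) = fst (hd p) + int (length p) - (1::int)"
  using assms
proof (induction p)
  case (Cons u p)
  show ?case
  proof (cases p)
    case (Cons v q)
    have "dyck_step u v"
      using Cons.prems Cons by simp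
    then have "fst v = fst u + 1"
      by (cases u) (auto simp: dyck_step_iff)
    then show ?thesis
      using Cons.IH Cons.prems Cons by simp
  qed simp
qed simp

text \<open>Each step advances the abscissa by one, so a path without horizontal displacement has a
  single vertex.\<close>

lemma paths_to_axis_0:
  "paths_to_axis 0 x (int h) = (if h = 0 then {[(x, 0)]} else {})"
proof -
  have only: "p = [(x, 0)] \<and> h = 0" if "p \<in> paths_to_axis 0 x (int h)" for p
  proof -
    have ends: "p \<noteq> []" "hd p = (x, int h)" "last p = (x, 0)"
      using that by (simp_all add: paths_to_axis_def)
    have "fst (last p) = fst (hd p) + int (length p) - 1"
      using that by (intro fst_last_path) (simp_all add: paths_to_axis_def)
    then have "length p = 1"
      using ends by simp
    then obtain v where "p = [v]"
      by (auto simp: length_Suc_conv)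
    then show ?thesis
      using ends by simp
  qed
  have "[(x, 0)] \<in> paths_to_axis 0 x (int h)" if "h = 0"
    using that by (simp add: paths_to_axis_def)
  then have "paths_to_axis 0 x (int h) = {[(x, 0)]}" if "h = 0"
    using only that by blast
  moreover have "paths_to_axis 0 x (int h) = {}" if "h \<noteq> 0"
    using only that by blast
  ultimately show ?thesis
    by (cases "h = 0") (simp_all only: if_True if_False simp_thms)
qed

lemma paths_to_axis_negative: "h < 0 \<Longrightarrow> paths_to_axis N x h = {}"
proof -
  assume "h < 0"
  then have False if "p \<in> paths_to_axis N x h" for p
    using that hd_in_set[of p] by (auto simp: paths_to_axis_def)
  then show ?thesis
    by blast
qed

lemma paths_to_axis_Suc:
  "paths_to_axis (Suc N) x (int h) =
     (#) (x, int h) ` (paths_to_axis N (x + 1) (int h + 1) \<union> paths_to_axis N (x + 1) (int h - 1))"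
    (is "?L = ?R")
proof (intro equalityI subsetI)
  fix p assume p: "p \<in> ?L"
  then obtain q where q: "p = (x, int h) # q"
    by (cases p) (auto simp: paths_to_axis_def)
  have "q \<noteq> []"
    using p q by (auto simp: paths_to_axis_def)
  then have "hd q = (x + 1, int h + 1) \<or> hd q = (x + 1, int h - 1)"
    using p q by (simp add: paths_to_axis_def successively_Cons dyck_step_iff)
  then show "p \<in> ?R"
  proof
    assume "hd q = (x + 1, int h + 1)"
    then have "q \<in> paths_to_axis N (x + 1) (int h + 1)"
      using p q \<open>q \<noteq> []\<close> by (simp add: paths_to_axis_def successively_Cons)
    then show ?thesis
      using q by blast
  next
    assume "hd q = (x + 1, int h - 1)"
    then have "q \<in> paths_to_axis N (x + 1) (int h - 1)"
      using p q \<open>q \<noteq> []\<close> by (simp add: paths_to_axis_def successively_Cons)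
    then show ?thesis
      using q by blast
  qed
next
  fix p assume "p \<in> ?R"
  then obtain q where "p = (x, int h) # q"
    "q \<in> paths_to_axis N (x + 1) (int h + 1) \<or> q \<in> paths_to_axis N (x + 1) (int h - 1)"
    by blast
  then show "p \<in> ?L"
    by (elim disjE) (simp_all add: paths_to_axis_def successively_Cons dyck_step_iff)
qed

lemma finite_paths_to_axis: "finite (paths_to_axis N x (int h))"
proof (induction N arbitrary: x h)
  case (Suc N)
  have "finite (paths_to_axis N (x + 1) (int h - 1))"
    using Suc.IH[of "x + 1" "h - 1"] paths_to_axis_negative[of "int h - 1"]
    by (cases "h = 0") (auto simp: of_nat_diff)
  moreover have "finite (paths_to_axis N (x + 1) (int h + 1))"
    using Suc.IH[of "x + 1" "Suc h"] by (simp add: add.commute)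
  ultimately show ?case
    by (simp add: paths_to_axis_Suc)
qed (simp add: paths_to_axis_0)

section \<open>Sums over paths and the adjacency operator of the half-line\<close>

definition neighbour_sum :: "(nat \<Rightarrow> real) \<Rightarrow> nat \<Rightarrow> real" where
  "neighbour_sum f h = f (Suc h) + (if h = 0 then 0 else f (h - 1))"

text \<open>The ballot numbers, real-valued because they are used only in sums and quotients of reals.\<close>

definition ballot :: "nat \<Rightarrow> nat \<Rightarrow> real" where
  "ballot r = (neighbour_sum ^^ r) (\<lambda>h. if h = 0 then 1 else 0)"

text \<open>A path from height \<open>h\<close> continues from one of the two neighbouring heights, or only from the
  upper one if \<open>h = 0\<close>.  The function \<open>G\<close> records what \<open>F\<close> becomes once the first vertex is removed:
  the constant \<open>1\<close> when counting, the height of the vertex with the preceding index when summing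
  heights.\<close>

lemma sum_paths_to_axis_Suc:
  assumes "\<And>k p. p \<in> paths_to_axis N (x + 1) (int k) \<Longrightarrow> F ((x, int h) # p) = G p"
  shows "(\<Sum>p\<in>paths_to_axis (Suc N) x (int h). F p) =
    neighbour_sum (\<lambda>k. \<Sum>p\<in>paths_to_axis N (x + 1) (int k). G p) h"
proof -
  define U where "U = paths_to_axis N (x + 1) (int (Suc h))"
  define D where "D = (if h = 0 then {} else paths_to_axis N (x + 1) (int (h - 1)))"
  have "paths_to_axis N (x + 1) (int h - 1) = D"
    using paths_to_axis_negative[of "- 1" N "x + 1"] by (simp add: D_def of_nat_diff)
  moreover have "paths_to_axis N (x + 1) (int h + 1) = U"
    by (simp add: U_def add.commute)
  ultimately have eq: "paths_to_axis (Suc N) x (int h) = (#) (x, int h) ` (U \<union> D)"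
    by (simp only: paths_to_axis_Suc)
  have disj: "U \<inter> D = {}"
  proof -
    have "hd p = (x + 1, int h + 1)" if "p \<in> U" for p
      using that by (simp add: U_def paths_to_axis_def)
    moreover have "hd p \<noteq> (x + 1, int h + 1)" if "p \<in> D" for p
      using that by (cases "h = 0") (simp_all add: D_def paths_to_axis_def of_nat_diff)
    ultimately show ?thesis
      by blast
  qed
  have fin: "finite U" "finite D"
    by (simp_all only: U_def D_def finite_paths_to_axis finite.emptyI if_split simp_thms)
  have FU: "F ((x, int h) # p) = G p" if "p \<in> U" for p
    using that unfolding U_def by (rule assms)
  have FD: "F ((x, int h) # p) = G p" if "p \<in> D" for p
    using that assms[of p "h - 1"] unfolding D_def by (cases "h = 0") simp_all
  have "(\<Sum>p\<in>paths_to_axis (Suc N) x (int h). F p) = (\<Sum>p\<in>U \<union> D. F ((x, int h) # p))"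
    unfolding eq using sum.reindex[of "(#) (x, int h)" "U \<union> D" F] by (simp add: o_def)
  also have "\<dots> = (\<Sum>p\<in>U \<union> D. G p)"
    using FU FD by (intro sum.cong) auto
  also have "\<dots> = (\<Sum>p\<in>U. G p) + (\<Sum>p\<in>D. G p)"
    using fin disj by (rule sum.union_disjoint)
  finally show ?thesis
    unfolding neighbour_sum_def U_def D_def by simp
qed

lemma card_paths_to_axis: "real (card (paths_to_axis N x (int h))) = ballot N h"
proof (induction N arbitrary: x h)
  case 0
  show ?case by (simp add: paths_to_axis_0 ballot_def)
next
  case (Suc N)
  show ?case
    using sum_paths_to_axis_Suc[of N x "\<lambda>_. 1" h "\<lambda>_. 1"] Suc.IH by (simp add: ballot_def)
qed

lemma sum_heights_paths_to_axis:
  "(\<Sum>p\<in>paths_to_axis (r + N) x (int h). real_of_int (vertex_height p r)) =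
     (neighbour_sum ^^ r) (\<lambda>k. real k * ballot N k) h"
proof (induction r arbitrary: x h)
  case 0
  have "vertex_height p 0 = int h" if "p \<in> paths_to_axis N x (int h)" for p
    using that by (cases p) (auto simp: paths_to_axis_def vertex_height_def)
  then show ?case
    by (simp add: card_paths_to_axis)
next
  case (Suc r)
  have "(\<Sum>p\<in>paths_to_axis (Suc (r + N)) x (int h). real_of_int (vertex_height p (Suc r))) =
      neighbour_sum (\<lambda>k. \<Sum>p\<in>paths_to_axis (r + N) (x + 1) (int k). real_of_int (vertex_height p r)) h"
    by (rule sum_paths_to_axis_Suc) (simp add: vertex_height_def)
  then show ?case
    by (simp add: Suc.IH)
qed

lemma ballot_above_diagonal: "r < h \<Longrightarrow> ballot r h = 0"
  by (induction r arbitrary: h) (auto simp: ballot_def neighbour_sum_def)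

lemma ballot_Suc: "ballot (Suc r) = neighbour_sum (ballot r)"
  by (simp add: ballot_def)

text \<open>Symmetry of the adjacency operator: summation by parts on the half-line, without a boundary
  term since \<open>ballot r\<close> vanishes above \<open>r\<close>.\<close>

lemma sum_ballot_neighbour_sum:
  "(\<Sum>h\<le>r. ballot r h * neighbour_sum f h) = (\<Sum>h\<le>Suc r. ballot (Suc r) h * f h)"
proof -
  have "(\<Sum>h\<le>Suc r. ballot (Suc r) h * f h) =
      (\<Sum>h\<le>Suc r. ballot r (Suc h) * f h) + (\<Sum>h\<le>Suc r. (if h = 0 then 0 else ballot r (h - 1)) * f h)"
    by (simp only: ballot_Suc neighbour_sum_def ring_distribs sum.distrib)
  also have "(\<Sum>h\<le>Suc r. (if h = 0 then 0 else ballot r (h - 1)) * f h) = (\<Sum>h\<le>r. ballot r h * f (Suc h))"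
    by (subst sum.atMost_Suc_shift) simp
  also have "(\<Sum>h\<le>Suc r. ballot r (Suc h) * f h) = (\<Sum>h\<le>r. ballot r (Suc h) * f h)"
    by (simp add: ballot_above_diagonal)
  also have "\<dots> = (\<Sum>h\<le>Suc r. ballot r h * (if h = 0 then 0 else f (h - 1)))"
    by (subst sum.atMost_Suc_shift) simp
  also have "\<dots> = (\<Sum>h\<le>r. ballot r h * (if h = 0 then 0 else f (h - 1)))"
    by (simp add: ballot_above_diagonal)
  finally show ?thesis
    by (simp add: neighbour_sum_def ring_distribs sum.distrib)
qed

text \<open>Evaluating an iterate at the origin amounts to cutting at time \<open>r\<close>: the paths of length \<open>r\<close>
  from the origin end at \<open>h\<close> with multiplicity \<open>ballot r h\<close>.\<close>

lemma neighbour_sum_funpow_0: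
  "(neighbour_sum ^^ r) f 0 = (\<Sum>h\<le>r. ballot r h * f h)"
proof (induction r arbitrary: f)
  case 0
  show ?case by (simp add: ballot_def)
next
  case (Suc r)
  have "(neighbour_sum ^^ Suc r) f 0 = (neighbour_sum ^^ r) (neighbour_sum f) 0"
    by (simp add: funpow_swap1)
  then show ?case
    using Suc.IH[of "neighbour_sum f"] by (simp only: sum_ballot_neighbour_sum)
qed

lemma average_height_plus_1:
  assumes "r + s = 2 * n" "ballot (2 * n) 0 \<noteq> 0"
  shows "average_height n r + 1 = (\<Sum>h\<le>r. real (h + 1) * ballot r h * ballot s h) / ballot (2 * n) 0"
proof -
  have "(\<Sum>p\<in>dyck_paths n. real_of_int (vertex_height p r)) =
      (\<Sum>h\<le>r. ballot r h * (real h * ballot s h))"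
    using sum_heights_paths_to_axis[of r s 0 0] assms
    by (simp add: dyck_paths_eq_paths_to_axis neighbour_sum_funpow_0)
  moreover have "ballot (2 * n) 0 = (\<Sum>h\<le>r. ballot r h * ballot s h)"
  proof -
    have "ballot (r + s) 0 = (neighbour_sum ^^ r) (ballot s) 0"
      by (simp add: ballot_def funpow_add)
    then show ?thesis
      using assms by (simp add: neighbour_sum_funpow_0)
  qed
  ultimately have "(\<Sum>p\<in>dyck_paths n. real_of_int (vertex_height p r)) + ballot (2 * n) 0 =
      (\<Sum>h\<le>r. real (h + 1) * ballot r h * ballot s h)"
    by (simp add: algebra_simps sum.distrib)
  moreover have "real (card (dyck_paths n)) = ballot (2 * n) 0"
    using card_paths_to_axis[of "2 * n" 0 0] by (simp add: dyck_paths_eq_paths_to_axis)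
  ultimately show ?thesis
    using assms(2) by (simp add: average_height_def field_simps)
qed

section \<open>Closed forms for the ballot numbers and their weighted convolution\<close>

text \<open>For \<open>r + h\<close> even this is the binomial coefficient of \<open>r + 1\<close> over \<open>(r - h) / 2\<close>, written with the
  complementary lower index: then no subtraction occurs and the value is automatically \<open>0\<close> for
  \<open>h > r\<close>.\<close>

definition ballot_binomial :: "nat \<Rightarrow> nat \<Rightarrow> real" where
  "ballot_binomial r h = (if even (r + h) then real (Suc r choose Suc ((r + h) div 2)) else 0)"

lemma Suc_times_binomial_real:
  "real (Suc k) * real (n choose Suc k) = (real n - real k) * real (n choose k)"
proof (cases "k \<le> n")
  case True
  have "Suc k * (n choose Suc k) = (n - k) * (n choose k)"
    by (simp only: binomial_absorption binomial_absorb_comp)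
  then have "real (Suc k * (n choose Suc k)) = real ((n - k) * (n choose k))"
    by simp
  then show ?thesis
    using True by (simp only: of_nat_mult of_nat_diff)
qed (simp add: binomial_eq_0)

text \<open>The ballot theorem, by induction on \<open>r\<close>.  At \<open>h = 0\<close> there is no lower neighbour, and the factor
  \<open>h\<close> in front of \<open>ballot_binomial r (h - 1)\<close> removes the meaningless value.\<close>

lemma ballot_eq: "real (Suc r) * ballot r h = real (Suc h) * ballot_binomial r h"
proof (induction r arbitrary: h)
  case 0
  show ?case
    by (auto simp: ballot_def ballot_binomial_def)
next
  case (Suc r)
  have D: "real (Suc r) * ballot (Suc r) h =
      real (h + 2) * ballot_binomial r (Suc h) + real h * ballot_binomial r (h - 1)"
    using Suc.IH[of "Suc h"] Suc.IH[of "h - 1"]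
    by (cases h) (simp_all add: ballot_def neighbour_sum_def algebra_simps)
  show ?case
  proof (cases "odd (r + h)")
    case False
    then show ?thesis
      using D by (cases h) (auto simp: ballot_binomial_def)
  next
    case True
    define j where "j = (r + h + 1) div 2"
    have j: "2 * real j = real r + real h + 1"
    proof -
      have "2 * j = r + h + 1"
        using True by (simp add: j_def)
      then show ?thesis
        using arg_cong[of "2 * j" "r + h + 1" real] by simp
    qed
    \<comment> \<open>Pascal's rule and the recurrence express both sides by the consecutive coefficients \<open>c\<close> and \<open>d\<close>,
      whose quotient is a rational function of \<open>r\<close> and \<open>h\<close>.\<close>
    define c d where "c = real (Suc r choose j)" and "d = real (Suc r choose Suc j)"
    have lhs: "ballot_binomial (Suc r) h = c + d"
      using True by (simp add: ballot_binomial_def j_def c_def d_def)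
    have "ballot_binomial r (Suc h) = d"
      using True by (simp add: ballot_binomial_def j_def d_def)
    have "real h * ballot_binomial r (h - 1) = real h * c"
    proof (cases h)
      case (Suc k)
      then have "Suc ((r + k) div 2) = j" using True by (auto simp: j_def)
      then show ?thesis using Suc True by (simp add: ballot_binomial_def c_def)
    qed simp
    have "real (Suc j) * d = (real (Suc r) - real j) * c"
      unfolding c_def d_def by (rule Suc_times_binomial_real)
    then have "(2 * real j + 2) * d = (2 * real r + 2 - 2 * real j) * c"
      by (simp add: algebra_simps)
    then have "(real r + real h + 3) * d = (real r + 1 - real h) * c"
      unfolding j by (simp add: algebra_simps)
    then have key: "(real r + 1) * (real h + 1) * (c + d) = (real r + 2) * ((real h + 2) * d + real h * c)"
      by algebra
    have "real (Suc r) * ballot (Suc r) h = real (h + 2) * d + real h * c"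
      using D by (simp only: \<open>ballot_binomial r (Suc h) = d\<close>
          \<open>real h * ballot_binomial r (h - 1) = real h * c\<close>)
    then have D': "(real r + 1) * ballot (Suc r) h = (real h + 2) * d + real h * c"
      by (simp add: add_ac)
    have "(real r + 1) * ((real r + 2) * ballot (Suc r) h) = (real r + 2) * ((real r + 1) * ballot (Suc r) h)"
      by (rule mult.left_commute)
    also have "\<dots> = (real r + 1) * ((real h + 1) * (c + d))"
      unfolding D' key[symmetric] by (rule mult.assoc)
    finally have "(real r + 1) * ((real r + 2) * ballot (Suc r) h) = (real r + 1) * ((real h + 1) * (c + d))" .
    then have "real (Suc r) * (real (Suc (Suc r)) * ballot (Suc r) h) =
       real (Suc r) * (real (Suc h) * ballot_binomial (Suc r) h)"
      unfolding lhs by (simp add: add_ac)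
    then show ?thesis
      by (simp only: mult_cancel_left) simp
  qed
qed

lemma ballot_binomial_step:
  "(real r + real h + 4) * ballot_binomial r (h + 2) = (real r - real h) * ballot_binomial r h"
proof (cases "even (r + h)")
  case True
  define j where "j = (r + h) div 2"
  have j: "2 * real j = real r + real h"
  proof -
    have "2 * j = r + h"
      using True by (simp add: j_def)
    then show ?thesis
      using arg_cong[of "2 * j" "r + h" real] by simp
  qed
  have "real (Suc (Suc j)) * real (Suc r choose Suc (Suc j)) =
      (real (Suc r) - real (Suc j)) * real (Suc r choose Suc j)"
    by (rule Suc_times_binomial_real)
  then have "(2 * real j + 4) * real (Suc r choose Suc (Suc j)) =
      (2 * real r - 2 * real j) * real (Suc r choose Suc j)"
    by (simp add: algebra_simps)
  then have "(real r + real h + 4) * real (Suc r choose Suc (Suc j)) =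
      (real r - real h) * real (Suc r choose Suc j)"
    unfolding j by (simp add: algebra_simps)
  then show ?thesis
    using True by (simp add: ballot_binomial_def j_def)
qed (simp add: ballot_binomial_def)

text \<open>The value at the lowest height of the right parity is a central binomial coefficient, up to
  factors that are exactly those of the telescoping term.\<close>

lemma ballot_binomial_parity:
  "(real r + real (r mod 2) + 2) * ballot_binomial r (r mod 2) = 2 * real (r + 1) * real (r choose (r div 2))"
proof (cases "even r")
  case True
  then obtain i where i: "r = 2 * i" by (auto elim: evenE)
  have "real (Suc i * (Suc (2 * i) choose Suc i)) = real (Suc (2 * i) * ((2 * i) choose i))"
    by (subst binomial_absorption) simp
  then show ?thesis
    using i by (simp add: ballot_binomial_def algebra_simps)
next
  case False
  then obtain i where i: "r = 2 * i + 1" by (auto elim: oddE)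
  define w where "w = real (Suc (Suc (2 * i)) choose Suc (Suc i))"
  have "real (Suc (Suc i) * (Suc (Suc (2 * i)) choose Suc (Suc i))) =
      real (Suc (Suc (2 * i)) * (Suc (2 * i) choose Suc i))"
    by (subst binomial_absorption) simp
  then have "real (Suc (Suc i)) * w = real (Suc (Suc (2 * i))) * real (Suc (2 * i) choose Suc i)"
    by (simp only: w_def of_nat_mult)
  moreover have "Suc (2 * i) choose Suc i = r choose (r div 2)"
    using central_binomial_odd[of "Suc (2 * i)"] i by simp
  moreover have "r mod 2 = 1" "(r + 1) div 2 = Suc i"
    using i by simp_all
  then have "ballot_binomial r (r mod 2) = w"
    using i by (simp add: ballot_binomial_def w_def del: binomial_Suc_Suc)
  ultimately show ?thesis
    using i \<open>r mod 2 = 1\<close> by (simp add: algebra_simps del: binomial_Suc_Suc)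
qed

lemma telescope_two_steps:
  fixes T :: "nat \<Rightarrow> real"
  shows "(\<Sum>h\<le>r. T h - T (h + 2)) = T 0 + T 1 - T (r + 1) - T (r + 2)"
  by (induction r) (simp_all add: numeral_2_eq_2)

text \<open>With \<open>R = r + 1\<close>, \<open>S = s + 1\<close>, \<open>k = h + 1\<close> and \<open>W h = ballot_binomial r h * ballot_binomial s h\<close>, the
  ansatz \<open>T h = q h * (R + k) * (S + k) * W h\<close> gives
  \<open>T (h + 2) = q (h + 2) * (R - k) * (S - k) * W h\<close>, so \<open>T h - T (h + 2)\<close> is a constant
  multiple of \<open>k^3 * W h\<close> as soon as \<open>q h * (R + k) * (S + k) - q (h + 2) * (R - k) * (S - k)\<close> is a
  constant multiple of \<open>k^3\<close>.  For \<open>q h = a + c * h^2\<close> the even powers of \<open>k\<close> cancel, and the linear one does if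
  \<open>(R + S) * (a + c) = 2 * c * R * S\<close>.  As \<open>R + S = 2 * (n + 1)\<close>, the choice \<open>c = n + 1\<close>,
  \<open>a = R * S - (n + 1)\<close> satisfies this.  The term \<open>dyck_delta n r\<close> then appears because
  \<open>q 0 = r * s + n\<close> and \<open>q 1 = r * s + 2 * n + 1\<close>.\<close>

lemma sum_ballot_ballot:
  assumes rs: "r + s = 2 * n" and n: "n \<ge> 1"
  shows "real n * real (n + 1) * (\<Sum>h\<le>r. real (h + 1) * ballot r h * ballot s h) =
    (real (dyck_delta n r) + real r * real s) * real (r choose (r div 2)) * real (s choose (s div 2))"
proof -
  define R S where "R = real r + 1" and "S = real s + 1"
  have RS: "R + S = 2 * real n + 2"
    using arg_cong[OF rs, of real] by (simp add: R_def S_def)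
  have pos: "R > 0" "S > 0" by (auto simp: R_def S_def)
  define c where "c = real n + 1"
  define a where "a = R * S - real n - 1"
  define W where "W h = ballot_binomial r h * ballot_binomial s h" for h
  define q where "q h = a + c * (real h)^2" for h
  define T where "T h = q h * (R + real h + 1) * (S + real h + 1) * W h" for h
  have step: "T h - T (h + 2) = 4 * real n * real (n + 1) * (real h + 1) ^ 3 * W h" for h
  proof -
    have "(R + real h + 3) * (S + real h + 3) * W (h + 2) = (R - (real h + 1)) * (S - (real h + 1)) * W h"
      using ballot_binomial_step[of r h] ballot_binomial_step[of s h]
      unfolding W_def R_def S_def by (simp add: algebra_simps) algebra
    moreover have "T (h + 2) = (a + c * (real h + 2)^2) * ((R + real h + 3) * (S + real h + 3) * W (h + 2))"
      unfolding T_def q_def of_nat_add of_nat_numeral by algebra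
    ultimately have "T (h + 2) = (a + c * (real h + 2)^2) * ((R - (real h + 1)) * (S - (real h + 1))) * W h"
      by (simp only: mult.assoc)
    then have "T h - T (h + 2) = (q h * (R + real h + 1) * (S + real h + 1)
       - (a + c * (real h + 2)^2) * ((R - (real h + 1)) * (S - (real h + 1)))) * W h"
      by (simp only: T_def left_diff_distrib)
    also have "q h * (R + real h + 1) * (S + real h + 1)
       - (a + c * (real h + 2)^2) * ((R - (real h + 1)) * (S - (real h + 1))) =
        4 * real n * real (n + 1) * (real h + 1) ^ 3"
    proof -
      have S: "S = 2 * real n + 2 - R" using RS by simp
      show ?thesis unfolding q_def a_def c_def S of_nat_add of_nat_1 by algebra
    qed
    finally show ?thesis .
  qed
  have W0: "W h = 0" if "r < h" for h
    using ballot_above_diagonal[OF that] ballot_eq[of r h] by (simp add: W_def)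
  have "4 * real n * real (n + 1) * (R * S * (\<Sum>h\<le>r. real (h + 1) * ballot r h * ballot s h)) =
      (\<Sum>h\<le>r. T h - T (h + 2))"
    unfolding sum_distrib_left step
  proof (rule sum.cong[OF refl])
    fix h
    have "R * ballot r h = (real h + 1) * ballot_binomial r h"
      "S * ballot s h = (real h + 1) * ballot_binomial s h"
      using ballot_eq[of r h] ballot_eq[of s h] by (simp_all add: R_def S_def algebra_simps)
    then have "R * S * (real (h + 1) * ballot r h * ballot s h) = (real h + 1) ^ 3 * W h"
      unfolding W_def of_nat_add of_nat_1 by algebra
    then show "4 * real n * real (n + 1) * (R * S * (real (h + 1) * ballot r h * ballot s h)) =
       4 * real n * real (n + 1) * (real h + 1) ^ 3 * W h"
      by (simp only: mult.assoc)
  qed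
  also have "\<dots> = T 0 + T 1"
    unfolding telescope_two_steps by (simp add: T_def W0)
  also have "\<dots> = T (r mod 2)"
    by (cases "even r") (auto simp: T_def W_def ballot_binomial_def odd_iff_mod_2_eq_one)
  also have "\<dots> = q (r mod 2) * ((R + real (r mod 2) + 1) * ballot_binomial r (r mod 2)) *
      ((S + real (s mod 2) + 1) * ballot_binomial s (s mod 2))"
  proof -
    have "r mod 2 = s mod 2"
      using rs by presburger
    then show ?thesis by (simp add: T_def W_def)
  qed
  also have "\<dots> = q (r mod 2) * (2 * R * real (r choose (r div 2))) * (2 * S * real (s choose (s div 2)))"
    using ballot_binomial_parity[of r] ballot_binomial_parity[of s]
    by (simp add: R_def S_def algebra_simps)
  also have "q (r mod 2) = real (dyck_delta n r) + real r * real s"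
  proof -
    have "real r + real s = 2 * real n" using rs by (simp flip: of_nat_add)
    moreover have "real (r mod 2) = (if even r then 0 else 1)" by (simp add: odd_iff_mod_2_eq_one)
    ultimately show ?thesis
      unfolding q_def a_def c_def R_def S_def dyck_delta_def by (simp add: algebra_simps)
  qed
  finally have "(4 * R * S) * (real n * real (n + 1) * (\<Sum>h\<le>r. real (h + 1) * ballot r h * ballot s h)) =
    (4 * R * S) * ((real (dyck_delta n r) + real r * real s) * real (r choose (r div 2)) * real (s choose (s div 2)))"
    by (simp only: mult_ac)
  then show ?thesis
    using pos by (simp only: mult_cancel_left) simp
qed

lemma ballot_catalan: "real (n + 1) * ballot (2 * n) 0 = real ((2 * n) choose n)"
proof -
  have "2 * real (n + 1) * ballot_binomial (2 * n) 0 = 2 * real (2 * n + 1) * real ((2 * n) choose n)"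
    using ballot_binomial_parity[of "2 * n"] by (simp add: algebra_simps)
  moreover have "real (2 * n + 1) * ballot (2 * n) 0 = ballot_binomial (2 * n) 0"
    using ballot_eq[of "2 * n" 0] by simp
  ultimately have "real (2 * n + 1) * (real (n + 1) * ballot (2 * n) 0) = real (2 * n + 1) * real ((2 * n) choose n)"
    by (simp only: mult_ac)
  then show ?thesis
    by (simp only: mult_cancel_left) simp
qed

lemma average_height_closed_form:
  assumes "n \<ge> 1" "r \<le> 2 * n"
  shows "average_height n r = (real (dyck_delta n r) + real r * (2 * real n - real r)) / real n *
     (real (r choose (r div 2)) * real ((2 * n - r) choose ((2 * n - r) div 2)) / real ((2 * n) choose n)) - 1"
proof -
  define s where "s = 2 * n - r"
  have rs: "r + s = 2 * n" and s: "real s = 2 * real n - real r"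
    using assms by (simp_all add: s_def of_nat_diff)
  define b where "b = ballot (2 * n) 0"
  have b: "real ((2 * n) choose n) = real (n + 1) * b"
    using ballot_catalan[of n] by (simp only: b_def)
  have "real ((2 * n) choose n) > 0"
    by simp
  then have b0: "b \<noteq> 0"
    using b by auto
  define X where "X = (\<Sum>h\<le>r. real (h + 1) * ballot r h * ballot s h)"
  have "average_height n r + 1 = X / b"
    using average_height_plus_1[OF rs] b0 by (simp add: b_def X_def)
  also have "\<dots> = (real n * real (n + 1) * X) / (real n * real (n + 1) * b)"
    using assms by (subst mult_divide_mult_cancel_left) auto
  also have "real n * real (n + 1) * X =
      (real (dyck_delta n r) + real r * real s) * real (r choose (r div 2)) * real (s choose (s div 2))"
    unfolding X_def by (rule sum_ballot_ballot[OF rs assms(1)])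
  finally show ?thesis
    unfolding b s_def[symmetric] s[symmetric] by (simp add: mult_ac)
qed

lemma binomial_complementary_half:
  assumes "r \<le> 2 * n"
  shows "(2 * n - r) choose (n - r div 2) = (2 * n - r) choose ((2 * n - r) div 2)"
proof (cases "even r")
  case True
  then have "(2 * n - r) div 2 = n - r div 2"
    using assms by (auto elim!: evenE)
  then show ?thesis by simp
next
  case False
  then have "odd (2 * n - r)" and "n - r div 2 = Suc ((2 * n - r) div 2)"
    using assms by presburger+
  then show ?thesis
    using central_binomial_odd by metis
qed

section \<open>Asymptotics of the central binomial coefficients\<close>

definition central_ratio :: "nat \<Rightarrow> real" where
  "central_ratio m = real (m choose (m div 2)) / 2 ^ m"

lemma gbinomial_minus_half: "((- 1 / 2 :: real) gchoose k) = (- 1) ^ k * real ((2 * k) choose k) / 4 ^ k"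
proof (induction k)
  case (Suc k)
  have "real (Suc k) * ((- 1 / 2 :: real) gchoose Suc k) = (- 1 / 2 - real k) * ((- 1 / 2) gchoose k)"
    by (simp only: gbinomial_absorption gbinomial_absorb_comp)
  moreover have central: "real (Suc k) * real ((2 * Suc k) choose Suc k) = 2 * (2 * real k + 1) * real ((2 * k) choose k)"
  proof -
    have "(2 * Suc k) choose Suc k = 2 * (Suc (2 * k) choose k)"
      using central_binomial_odd[of "Suc (2 * k)"] by simp
    moreover have "Suc (2 * k) choose k = Suc (2 * k) choose Suc k"
      using central_binomial_odd[of "Suc (2 * k)"] by simp
    moreover have "real (Suc k * (Suc (2 * k) choose Suc k)) = real (Suc (2 * k) * ((2 * k) choose k))"
      by (subst binomial_absorption) simp
    ultimately show ?thesis
      by (simp add: algebra_simps del: binomial_Suc_Suc)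
  qed
  moreover have "real (Suc k) * ((- 1) ^ Suc k * real ((2 * Suc k) choose Suc k) / 4 ^ Suc k) =
      (- 1) ^ Suc k / 4 ^ Suc k * (real (Suc k) * real ((2 * Suc k) choose Suc k))"
    by (simp only: times_divide_eq_right times_divide_eq_left mult_ac)
  then have "real (Suc k) * ((- 1) ^ Suc k * real ((2 * Suc k) choose Suc k) / 4 ^ Suc k) =
      (- 1 / 2 - real k) * ((- 1) ^ k * real ((2 * k) choose k) / 4 ^ k)"
    unfolding central by (simp add: field_simps)
  ultimately have "real (Suc k) * ((- 1 / 2 :: real) gchoose Suc k) =
     real (Suc k) * ((- 1) ^ Suc k * real ((2 * Suc k) choose Suc k) / 4 ^ Suc k)"
    by (simp only: Suc.IH)
  then show ?case
    by (simp only: mult_cancel_left) simp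
qed simp

text \<open>The asymptotics of generalised binomial coefficients, at upper index \<open>- 1 / 2\<close>, where the
  limit is the inverse of \<open>Gamma (1 / 2) = sqrt pi\<close>.\<close>

lemma tendsto_central_binomial:
  "(\<lambda>k. real ((2 * k) choose k) / 4 ^ k * sqrt (real k)) \<longlonglongrightarrow> 1 / sqrt pi"
proof -
  have "(\<lambda>k. ((- 1 / 2 :: real) gchoose k) / ((- 1) ^ k / exp ((- 1 / 2 + 1) * of_real (ln (real k)))))
      \<longlonglongrightarrow> inverse (Gamma (- (- 1 / 2)))"
    by (rule gbinomial_asymptotic)
  moreover have "\<forall>\<^sub>F k in sequentially.
      ((- 1 / 2 :: real) gchoose k) / ((- 1) ^ k / exp ((- 1 / 2 + 1) * of_real (ln (real k)))) =
      real ((2 * k) choose k) / 4 ^ k * sqrt (real k)"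
    using eventually_gt_at_top[of 0]
  proof eventually_elim
    case (elim k)
    have "exp (ln (real k) / 2) = sqrt (real k)"
    proof -
      have "exp (ln (real k) / 2) = exp (ln (sqrt (real k)))"
        using elim by (simp only: ln_sqrt of_nat_0_less_iff)
      then show ?thesis
        using elim by simp
    qed
    then show ?case
      unfolding gbinomial_minus_half by simp
  qed
  ultimately have "(\<lambda>k. real ((2 * k) choose k) / 4 ^ k * sqrt (real k)) \<longlonglongrightarrow> inverse (Gamma (- (- 1 / 2)))"
    by (rule Lim_transform_eventually)
  moreover have "inverse (Gamma (- (- 1 / 2))) = 1 / sqrt pi"
    by (simp add: Gamma_one_half_real inverse_eq_divide)
  ultimately show ?thesis by simp
qed

text \<open>Rounding \<open>m\<close> up to an even number does not change the ratio: for odd \<open>m\<close>, the middle binomial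
  coefficient of \<open>m + 1\<close> is twice that of \<open>m\<close>.\<close>

lemma central_ratio_eq:
  "central_ratio m = real ((2 * ((m + 1) div 2)) choose ((m + 1) div 2)) / 4 ^ ((m + 1) div 2)"
proof (cases "even m")
  case True
  then obtain k where "m = 2 * k" by (auto elim: evenE)
  then show ?thesis by (simp add: central_ratio_def power_mult)
next
  case False
  then obtain k where k: "m = 2 * k + 1" by (auto elim: oddE)
  have "(2 * Suc k) choose Suc k = 2 * (Suc (2 * k) choose k)"
    using central_binomial_odd[of "Suc (2 * k)"] by simp
  then have "real ((2 * Suc k) choose Suc k) = 2 * real (Suc (2 * k) choose k)"
    by simp
  moreover have "(m + 1) div 2 = Suc k" "m div 2 = k" using k by simp_all
  ultimately show ?thesis
    using k by (simp add: central_ratio_def power_mult del: binomial_Suc_Suc)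
qed

lemma tendsto_central_ratio: "(\<lambda>m. central_ratio m * sqrt (real m)) \<longlonglongrightarrow> sqrt (2 / pi)"
proof -
  have lim_half: "filterlim (\<lambda>m::nat. (m + 1) div 2) at_top sequentially"
    unfolding filterlim_at_top
  proof
    fix Z :: nat
    show "\<forall>\<^sub>F m in sequentially. Z \<le> (m + 1) div 2"
      using eventually_ge_at_top[of "2 * Z"] by eventually_elim simp
  qed
  have "(\<lambda>m. real m / real ((m + 1) div 2)) \<longlonglongrightarrow> 2"
  proof (rule tendsto_sandwich)
    show "\<forall>\<^sub>F m in sequentially. 2 - 2 / real (m + 1) \<le> real m / real ((m + 1) div 2)"
      using eventually_gt_at_top[of 0]
    proof eventually_elim
      case (elim m)
      have "2 * real ((m + 1) div 2) \<le> real (m + 1)" "real ((m + 1) div 2) > 0"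
        using elim by linarith+
      then have "real m / (real (m + 1) / 2) \<le> real m / real ((m + 1) div 2)"
        by (intro divide_left_mono) auto
      then show ?case
        by (simp add: field_simps)
    qed
    show "\<forall>\<^sub>F m in sequentially. real m / real ((m + 1) div 2) \<le> 2"
      using eventually_gt_at_top[of 0]
    proof eventually_elim
      case (elim m)
      have "real m \<le> 2 * real ((m + 1) div 2)" "real ((m + 1) div 2) > 0"
        using elim by linarith+
      then show ?case
        by (simp add: field_simps)
    qed
    show "(\<lambda>m. 2 - 2 / real (m + 1)) \<longlonglongrightarrow> 2"
      by real_asymp
  qed simp
  then have "(\<lambda>m. sqrt (real m / real ((m + 1) div 2))) \<longlonglongrightarrow> sqrt 2"
    by (rule tendsto_real_sqrt)
  then have "(\<lambda>m. (real ((2 * ((m + 1) div 2)) choose ((m + 1) div 2)) / 4 ^ ((m + 1) div 2) *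
       sqrt (real ((m + 1) div 2))) * sqrt (real m / real ((m + 1) div 2))) \<longlonglongrightarrow> 1 / sqrt pi * sqrt 2"
    by (intro tendsto_mult filterlim_compose[OF tendsto_central_binomial lim_half])
  moreover have "\<forall>\<^sub>F m in sequentially. (real ((2 * ((m + 1) div 2)) choose ((m + 1) div 2)) / 4 ^ ((m + 1) div 2) *
       sqrt (real ((m + 1) div 2))) * sqrt (real m / real ((m + 1) div 2)) = central_ratio m * sqrt (real m)"
    using eventually_gt_at_top[of 0]
  proof eventually_elim
    case (elim m)
    then have "real ((m + 1) div 2) > 0" by linarith
    then have "sqrt (real ((m + 1) div 2)) * sqrt (real m / real ((m + 1) div 2)) = sqrt (real m)"
      by (simp add: real_sqrt_divide)
    then show ?case
      by (simp only: central_ratio_eq mult.assoc)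
  qed
  ultimately have "(\<lambda>m. central_ratio m * sqrt (real m)) \<longlonglongrightarrow> 1 / sqrt pi * sqrt 2"
    by (rule Lim_transform_eventually)
  then show ?thesis
    by (simp add: real_sqrt_divide)
qed

section \<open>Limits of the average height\<close>

lemma average_height_central_ratio:
  assumes "n \<ge> 1" "r + s = 2 * n"
  shows "average_height n r = (real (dyck_delta n r) + real r * real s) / real n *
     (central_ratio r * central_ratio s / central_ratio (2 * n)) - 1"
proof -
  have "r \<le> 2 * n" "2 * n - r = s" "2 * real n - real r = real s"
    using assms by auto
  moreover have "central_ratio r * central_ratio s / central_ratio (2 * n) =
     real (r choose (r div 2)) * real (s choose (s div 2)) / real ((2 * n) choose n)"
  proof -
    have "(2::real) ^ (2 * n) = 2 ^ r * 2 ^ s"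
      using assms(2) by (metis power_add)
    then show ?thesis
      by (simp add: central_ratio_def)
  qed
  ultimately show ?thesis
    using average_height_closed_form[of n r] assms(1) by simp
qed

lemma central_ratio_pos: "central_ratio m > 0"
  by (simp add: central_ratio_def)

text \<open>Both parities at once: they differ only in the limit \<open>d\<close> of \<open>dyck_delta n r / n\<close>, which is
  \<open>1\<close> or \<open>2\<close>.\<close>

lemma tendsto_average_height_fixed:
  assumes "(\<lambda>n. real (dyck_delta n r) / real n) \<longlonglongrightarrow> d"
  shows "(\<lambda>n. average_height n r) \<longlonglongrightarrow> (d + 2 * real r) * central_ratio r - 1"
proof -
  let ?s = "\<lambda>n. 2 * n - r"
  have lim_s: "filterlim ?s at_top sequentially"
    unfolding filterlim_at_top
  proof
    fix Z
    show "\<forall>\<^sub>F n in sequentially. Z \<le> 2 * n - r"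
      using eventually_ge_at_top[of "Z + r"] by eventually_elim simp
  qed
  have lim_2n: "filterlim (\<lambda>n::nat. 2 * n) at_top sequentially"
    by (rule filterlim_subseq) (simp add: strict_mono_def)
  have "(\<lambda>n. (central_ratio (?s n) * sqrt (real (?s n))) / (central_ratio (2 * n) * sqrt (real (2 * n))) *
       sqrt (2 * real n / (2 * real n - real r))) \<longlonglongrightarrow> sqrt (2 / pi) / sqrt (2 / pi) * sqrt 1"
  proof (intro tendsto_mult tendsto_divide tendsto_real_sqrt)
    show "(\<lambda>n. central_ratio (?s n) * sqrt (real (?s n))) \<longlonglongrightarrow> sqrt (2 / pi)"
      by (rule filterlim_compose[OF tendsto_central_ratio lim_s])
    show "(\<lambda>n. central_ratio (2 * n) * sqrt (real (2 * n))) \<longlonglongrightarrow> sqrt (2 / pi)"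
      by (rule filterlim_compose[OF tendsto_central_ratio lim_2n])
    show "(\<lambda>n. 2 * real n / (2 * real n - real r)) \<longlonglongrightarrow> 1"
      by real_asymp
  qed simp
  moreover have "\<forall>\<^sub>F n in sequentially.
      (central_ratio (?s n) * sqrt (real (?s n))) / (central_ratio (2 * n) * sqrt (real (2 * n))) *
       sqrt (2 * real n / (2 * real n - real r)) = central_ratio (?s n) / central_ratio (2 * n)"
    using eventually_gt_at_top[of r]
  proof eventually_elim
    case (elim n)
    then have "real (?s n) = 2 * real n - real r" "2 * real n - real r > 0" "real n > 0"
      by (auto simp: of_nat_diff)
    then show ?case
      using central_ratio_pos[of "2 * n"] by (simp add: real_sqrt_divide)
  qed
  ultimately have "(\<lambda>n. central_ratio (?s n) / central_ratio (2 * n)) \<longlonglongrightarrow> sqrt (2 / pi) / sqrt (2 / pi) * sqrt 1"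
    by (rule Lim_transform_eventually)
  then have quot: "(\<lambda>n. central_ratio (?s n) / central_ratio (2 * n)) \<longlonglongrightarrow> 1"
    by simp
  have "(\<lambda>n. real r * (2 * real n - real r) / real n) \<longlonglongrightarrow> 2 * real r"
    by real_asymp
  then have "(\<lambda>n. (real (dyck_delta n r) / real n + real r * (2 * real n - real r) / real n) *
      central_ratio r * (central_ratio (?s n) / central_ratio (2 * n)) - 1)
      \<longlonglongrightarrow> (d + 2 * real r) * central_ratio r * 1 - 1"
    by (intro tendsto_intros assms quot)
  moreover have "\<forall>\<^sub>F n in sequentially.
     (real (dyck_delta n r) / real n + real r * (2 * real n - real r) / real n) *
      central_ratio r * (central_ratio (?s n) / central_ratio (2 * n)) - 1 = average_height n r"
    using eventually_gt_at_top[of r]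
  proof eventually_elim
    case (elim n)
    then have "n \<ge> 1" "r + ?s n = 2 * n" "real (?s n) = 2 * real n - real r" by (auto simp: of_nat_diff)
    then show ?case
      by (simp only: average_height_central_ratio) (simp add: add_divide_distrib)
  qed
  ultimately have "(\<lambda>n. average_height n r) \<longlonglongrightarrow> (d + 2 * real r) * central_ratio r * 1 - 1"
    by (rule Lim_transform_eventually)
  then show ?thesis by simp
qed

text \<open>The factor \<open>dyck_delta n r + r * s\<close> is asymptotically \<open>r * s\<close>, since
  \<open>dyck_delta n r \<le> r + s + 1\<close>, and the quotient of the central ratios behaves like
  \<open>sqrt (2 / pi) * sqrt (2 * n / (r * s))\<close>; together they give \<open>2 / sqrt pi * sqrt (r * s / n)\<close>.  The
  summand \<open>- 1\<close> is negligible because \<open>n / (r * s) = (1 / r + 1 / s) / 2\<close> tends to \<open>0\<close>.\<close>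

lemma average_height_asymptotic:
  fixes r s :: "nat \<Rightarrow> nat"
  assumes rs: "\<And>n. n \<ge> 1 \<Longrightarrow> r n + s n = 2 * n"
    and r: "filterlim r at_top sequentially" and s: "filterlim s at_top sequentially"
  shows "(\<lambda>n. average_height n (r n) / (2 / sqrt pi * sqrt (real (r n) * real (s n) / real n))) \<longlonglongrightarrow> 1"
proof -
  define C where "C m = central_ratio m * sqrt (real m)" for m
  have C: "C \<longlonglongrightarrow> sqrt (2 / pi)"
    unfolding C_def by (rule tendsto_central_ratio)
  have lim_2n: "filterlim (\<lambda>n::nat. 2 * n) at_top sequentially"
    by (rule filterlim_subseq) (simp add: strict_mono_def)
  have ev: "\<forall>\<^sub>F n in sequentially. n \<ge> 1 \<and> r n \<ge> 1 \<and> s n \<ge> 1"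
    using r s eventually_ge_at_top[of 1] unfolding filterlim_at_top
    by (intro eventually_conj) auto
  have inv_r: "(\<lambda>n. 1 / real (r n)) \<longlonglongrightarrow> 0"
    using filterlim_compose[OF lim_1_over_n r] by simp
  have inv_s: "(\<lambda>n. 1 / real (s n)) \<longlonglongrightarrow> 0"
    using filterlim_compose[OF lim_1_over_n s] by simp
  have two_n: "2 * real n = real (r n) + real (s n)" if "n \<ge> 1" for n
    using arg_cong[OF rs[OF that], of real] by simp
  have delta: "(\<lambda>n. real (dyck_delta n (r n)) / (real (r n) * real (s n))) \<longlonglongrightarrow> 0"
  proof (rule tendsto_sandwich[OF _ _ tendsto_const])
    show "\<forall>\<^sub>F n in sequentially. 0 \<le> real (dyck_delta n (r n)) / (real (r n) * real (s n))"
      by simp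
    show "\<forall>\<^sub>F n in sequentially. real (dyck_delta n (r n)) / (real (r n) * real (s n)) \<le>
        1 / real (r n) + 1 / real (s n) + 1 / real (r n) * (1 / real (s n))"
      using ev
    proof eventually_elim
      case (elim n)
      have "real (dyck_delta n (r n)) \<le> real (r n) + real (s n) + 1"
        using two_n[of n] elim by (auto simp: dyck_delta_def)
      moreover have "real (r n) > 0" "real (s n) > 0"
        using elim by auto
      ultimately show ?case
        by (simp add: field_simps)
    qed
    have "(\<lambda>n. 1 / real (r n) + 1 / real (s n) + 1 / real (r n) * (1 / real (s n))) \<longlonglongrightarrow> 0 + 0 + 0 * 0"
      by (intro tendsto_intros inv_r inv_s)
    then show "(\<lambda>n. 1 / real (r n) + 1 / real (s n) + 1 / real (r n) * (1 / real (s n))) \<longlonglongrightarrow> 0"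
      by simp
  qed
  have "(\<lambda>n. sqrt ((1 / real (r n) + 1 / real (s n)) / 2)) \<longlonglongrightarrow> sqrt ((0 + 0) / 2)"
    by (intro tendsto_intros inv_r inv_s) simp
  then have small: "(\<lambda>n. sqrt ((1 / real (r n) + 1 / real (s n)) / 2)) \<longlonglongrightarrow> 0"
    by simp
  \<comment> \<open>The quotient whose limit is sought, rewritten in terms of quantities with known limits.\<close>
  have "(\<lambda>n. (real (dyck_delta n (r n)) / (real (r n) * real (s n)) + 1) * sqrt (pi / 2) *
       (C (r n) * C (s n) / C (2 * n)) - sqrt pi / 2 * sqrt ((1 / real (r n) + 1 / real (s n)) / 2))
      \<longlonglongrightarrow> (0 + 1) * sqrt (pi / 2) * (sqrt (2 / pi) * sqrt (2 / pi) / sqrt (2 / pi)) - sqrt pi / 2 * 0"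
    by (intro tendsto_intros delta small filterlim_compose[OF C r] filterlim_compose[OF C s]
        filterlim_compose[OF C lim_2n]) simp
  also have "(0 + 1) * sqrt (pi / 2) * (sqrt (2 / pi) * sqrt (2 / pi) / sqrt (2 / pi)) - sqrt pi / 2 * 0 = 1"
  proof -
    have "sqrt (pi / 2) * sqrt (2 / pi) = 1"
      by (simp flip: real_sqrt_mult)
    moreover have "(0 + 1) * v * (u * u / u) - w * 0 = v * u" if "u \<noteq> 0" for u v w :: real
      using that by simp
    moreover have "sqrt (2 / pi) \<noteq> 0"
      by simp
    ultimately show ?thesis
      by metis
  qed
  finally have main: "(\<lambda>n. (real (dyck_delta n (r n)) / (real (r n) * real (s n)) + 1) * sqrt (pi / 2) *
       (C (r n) * C (s n) / C (2 * n)) - sqrt pi / 2 * sqrt ((1 / real (r n) + 1 / real (s n)) / 2)) \<longlonglongrightarrow> 1" .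
  have "\<forall>\<^sub>F n in sequentially. (real (dyck_delta n (r n)) / (real (r n) * real (s n)) + 1) * sqrt (pi / 2) *
       (C (r n) * C (s n) / C (2 * n)) - sqrt pi / 2 * sqrt ((1 / real (r n) + 1 / real (s n)) / 2) =
     average_height n (r n) / (2 / sqrt pi * sqrt (real (r n) * real (s n) / real n))"
    using ev
  proof eventually_elim
    case (elim n)
    define a b d where "a = sqrt (real (r n))" and "b = sqrt (real (s n))" and "d = sqrt (real n)"
    define p t where "p = sqrt pi" and "t = sqrt 2"
    have pos: "a > 0" "b > 0" "d > 0" "p > 0" "t > 0"
      using elim by (auto simp: a_def b_def d_def p_def t_def)
    have sq: "real (r n) = a\<^sup>2" "real (s n) = b\<^sup>2" "real n = d\<^sup>2"
      by (auto simp: a_def b_def d_def)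
    have c: "central_ratio (2 * n) > 0"
      by (rule central_ratio_pos)
    have n: "real n = (real (r n) + real (s n)) / 2"
      using two_n[of n] elim by simp
    have "(1 / real (r n) + 1 / real (s n)) / 2 = real n / (real (r n) * real (s n))"
      using elim unfolding n by (simp add: field_simps)
    then have S: "sqrt ((1 / real (r n) + 1 / real (s n)) / 2) = d / (a * b)"
      by (simp only: real_sqrt_divide real_sqrt_mult a_def b_def d_def)
    have D: "2 / sqrt pi * sqrt (real (r n) * real (s n) / real n) = 2 / p * (a * b / d)"
      by (simp only: real_sqrt_divide real_sqrt_mult a_def b_def d_def p_def)
    have C': "C (r n) = central_ratio (r n) * a" "C (s n) = central_ratio (s n) * b"
      "C (2 * n) = central_ratio (2 * n) * (t * d)"
      by (simp_all add: C_def a_def b_def d_def t_def real_sqrt_mult)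
    have P: "sqrt (pi / 2) = p * t / 2" "sqrt pi = p"
      by (simp_all add: p_def t_def real_sqrt_divide real_div_sqrt field_simps)
    have avg: "average_height n (r n) = (real (dyck_delta n (r n)) + a\<^sup>2 * b\<^sup>2) / d\<^sup>2 *
     (central_ratio (r n) * central_ratio (s n) / central_ratio (2 * n)) - 1"
      using average_height_central_ratio[of n "r n" "s n"] rs[of n] elim by (simp add: sq)
    have "(x / (a\<^sup>2 * b\<^sup>2) + 1) * (p * t / 2) * ((u * a) * (v * b) / (w * (t * d))) - p / 2 * (d / (a * b)) =
        ((x + a\<^sup>2 * b\<^sup>2) / d\<^sup>2 * (u * v / w) - 1) / (2 / p * (a * b / d))" if "w > 0" for u v w x
      using pos that by (simp add: field_simps power2_eq_square)
    from this[OF c] show ?case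
      unfolding S D avg unfolding C' P unfolding sq(1,2) .
  qed
  then show ?thesis
    by (rule Lim_transform_eventually[OF main])
qed

theorem theorem3p2:
  "(\<forall>n r :: nat. n \<ge> 1 \<longrightarrow> r \<le> 2 * n \<longrightarrow>
      average_height n r =
        (real (dyck_delta n r) + real r * (2 * real n - real r)) / real n *
        (real (r choose (r div 2)) * real ((2 * n - r) choose (n - r div 2)) /
          real ((2 * n) choose n)) - 1) \<and>
   (\<forall>r :: nat. even r \<longrightarrow>
      (\<lambda>n. average_height n r)
        \<longlonglongrightarrow> (2 * real r + 1) / 2 ^ r * real (r choose (r div 2)) - 1) \<and>
   (\<forall>r :: nat. odd r \<longrightarrow>
      (\<lambda>n. average_height n r)
        \<longlonglongrightarrow> (2 * real r + 2) / 2 ^ r * real (r choose ((r - 1) div 2)) - 1) \<and>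
   (\<forall>r :: nat \<Rightarrow> nat. (\<forall>n\<ge>1. r n \<le> 2 * n) \<longrightarrow>
      filterlim r at_top sequentially \<longrightarrow>
      filterlim (\<lambda>n. 2 * n - r n) at_top sequentially \<longrightarrow>
      (\<lambda>n. average_height n (r n) /
            (2 / sqrt pi * sqrt (real (r n) * (2 - real (r n) / real n)))) \<longlonglongrightarrow> 1)"
proof (intro conjI allI impI)
  fix n r :: nat assume "n \<ge> 1" "r \<le> 2 * n"
  then show "average_height n r =
        (real (dyck_delta n r) + real r * (2 * real n - real r)) / real n *
        (real (r choose (r div 2)) * real ((2 * n - r) choose (n - r div 2)) /
          real ((2 * n) choose n)) - 1"
    by (simp only: average_height_closed_form binomial_complementary_half)
next
  fix r :: nat assume "even r"
  have "(\<lambda>n. real n / real n) \<longlonglongrightarrow> 1"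
    by real_asymp
  then have "(\<lambda>n. average_height n r) \<longlonglongrightarrow> (1 + 2 * real r) * central_ratio r - 1"
    using \<open>even r\<close> by (intro tendsto_average_height_fixed) (simp add: dyck_delta_def)
  then show "(\<lambda>n. average_height n r)
        \<longlonglongrightarrow> (2 * real r + 1) / 2 ^ r * real (r choose (r div 2)) - 1"
    by (simp add: central_ratio_def add.commute)
next
  fix r :: nat assume "odd r"
  have "(\<lambda>n. real (2 * n + 1) / real n) \<longlonglongrightarrow> 2"
    by real_asymp
  then have "(\<lambda>n. average_height n r) \<longlonglongrightarrow> (2 + 2 * real r) * central_ratio r - 1"
    using \<open>odd r\<close> by (intro tendsto_average_height_fixed) (simp add: dyck_delta_def)
  moreover have "(r - 1) div 2 = r div 2"
    using \<open>odd r\<close> by (auto elim: oddE)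
  ultimately show "(\<lambda>n. average_height n r)
        \<longlonglongrightarrow> (2 * real r + 2) / 2 ^ r * real (r choose ((r - 1) div 2)) - 1"
    by (simp add: central_ratio_def add.commute)
next
  fix r :: "nat \<Rightarrow> nat"
  assume le: "\<forall>n\<ge>1. r n \<le> 2 * n" and r: "filterlim r at_top sequentially"
    and s: "filterlim (\<lambda>n. 2 * n - r n) at_top sequentially"
  have "(\<lambda>n. average_height n (r n) /
      (2 / sqrt pi * sqrt (real (r n) * real (2 * n - r n) / real n))) \<longlonglongrightarrow> 1"
    using le by (intro average_height_asymptotic r s) simp
  moreover have "\<forall>\<^sub>F n in sequentially. average_height n (r n) /
      (2 / sqrt pi * sqrt (real (r n) * real (2 * n - r n) / real n)) =
     average_height n (r n) / (2 / sqrt pi * sqrt (real (r n) * (2 - real (r n) / real n)))"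
    using eventually_ge_at_top[of 1]
  proof eventually_elim
    case (elim n)
    then have "real (r n) * real (2 * n - r n) / real n = real (r n) * (2 - real (r n) / real n)"
      using le by (simp add: of_nat_diff field_simps)
    then show ?case by (simp only:)
  qed
  ultimately show "(\<lambda>n. average_height n (r n) /
            (2 / sqrt pi * sqrt (real (r n) * (2 - real (r n) / real n)))) \<longlonglongrightarrow> 1"
    by (rule Lim_transform_eventually)
qed

end
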